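(* Let $G$ be a $\{(2,2)\text{-bowtie}, P_5, (3,3)\text{-dumbbell}\}$-free graph with $\omega(G) \ge 3$. Then \[ \chi(G) \le 2\omega(G) + \omega(G)\binom{\omega(G)}{2} + 2. \]
   Context: All graphs are finite, simple and undirected; "$H$-free" means having no induced subgraph isomorphic to $H$. $P_5$ is the path on $5$ vertices. $\chi(G)$ is the chromatic number and $\omega(G)$ the clique number. The $(2,2)$-bowtie is obtained from two disjoint copies of $K_2$ by adding a new vertex adjacent to all four of their vertices. The $(3,3)$-dumbbell is obtained from two disjoint copies of $K_3$ by adding a single edge between a vertex of one and a vertex of the other. *)

theory Defs
  imports "Graph_Theory.Pair_Digraph" "Graph_Theory.Digraph_Isomorphism"
begin

text \<open>
  Finite simple undirected graphs are the \<open>pair_graph\<close>s of \<open>Graph_Theory\<close>: loop-free pair digraphs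
  with finitely many vertices and a symmetric arc relation, so an edge \<open>uv\<close> is the pair of arcs
  \<open>(u, v)\<close>, \<open>(v, u)\<close>.
\<close>

definition contains_induced :: "'a pair_pre_digraph \<Rightarrow> 'b pair_pre_digraph \<Rightarrow> bool" where
  "contains_induced G H \<longleftrightarrow>
     (\<exists>S. induced_subgraph S (with_proj G) \<and> digraph_iso S (with_proj H))"

definition free_of :: "'b pair_pre_digraph set \<Rightarrow> 'a pair_pre_digraph \<Rightarrow> bool" where
  "free_of \<H> G \<longleftrightarrow> (\<forall>H\<in>\<H>. \<not> contains_induced G H)"

definition proper_coloring :: "'a pair_pre_digraph \<Rightarrow> nat \<Rightarrow> ('a \<Rightarrow> nat) \<Rightarrow> bool" where
  "proper_coloring G k c \<longleftrightarrow>
     c ` pverts G \<subseteq> {..<k} \<and> (\<forall>(u, v)\<in>parcs G. c u \<noteq> c v)"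

definition chromatic_number :: "'a pair_pre_digraph \<Rightarrow> nat" where
  "chromatic_number G = (LEAST k. \<exists>c. proper_coloring G k c)"

definition is_clique :: "'a pair_pre_digraph \<Rightarrow> 'a set \<Rightarrow> bool" where
  "is_clique G K \<longleftrightarrow> K \<subseteq> pverts G \<and> (\<forall>u\<in>K. \<forall>v\<in>K. u \<noteq> v \<longrightarrow> (u, v) \<in> parcs G)"

definition clique_number :: "'a pair_pre_digraph \<Rightarrow> nat" where
  "clique_number G = Max {card K | K. is_clique G K}"

definition complete_arcs :: "'a set \<Rightarrow> 'a rel" where
  "complete_arcs A = {(u, v). u \<in> A \<and> v \<in> A \<and> u \<noteq> v}"

definition path_graph :: "nat \<Rightarrow> nat pair_pre_digraph" where
  "path_graph n =
     \<lparr> pverts = {..<n},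
       parcs = {(i, j). i < n \<and> j < n \<and> (j = Suc i \<or> i = Suc j)} \<rparr>"

text \<open>The two copies of \<open>K\<^sub>2\<close> are on \<open>{0, 1}\<close> and \<open>{2, 3}\<close>, and \<open>4\<close> is the new vertex.\<close>

definition bowtie_2_2 :: "nat pair_pre_digraph" where
  "bowtie_2_2 =
     \<lparr> pverts = {0, 1} \<union> {2, 3} \<union> {4},
       parcs = complete_arcs {0, 1} \<union> complete_arcs {2, 3}
         \<union> {4} \<times> ({0, 1} \<union> {2, 3}) \<union> ({0, 1} \<union> {2, 3}) \<times> {4} \<rparr>"

text \<open>The two triangles are on \<open>{0, 1, 2}\<close> and \<open>{3, 4, 5}\<close>, joined by the edge between \<open>0\<close> and \<open>3\<close>.\<close>

definition dumbbell_3_3 :: "nat pair_pre_digraph" where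
  "dumbbell_3_3 =
     \<lparr> pverts = {0, 1, 2} \<union> {3, 4, 5},
       parcs = complete_arcs {0, 1, 2} \<union> complete_arcs {3, 4, 5} \<union> {(0, 3), (3, 0)} \<rparr>"

lemma pair_graph_path_graph: "pair_graph (path_graph n)"
  by unfold_locales (auto simp: path_graph_def symmetric_def arcs_ends_def arc_to_ends_def intro!: symI
      intro: finite_subset[of _ "{..<n} \<times> {..<n}"])

lemma complete_arcs_subset: "A \<subseteq> V \<Longrightarrow> complete_arcs A \<subseteq> V \<times> V"
  by (auto simp: complete_arcs_def)

lemma pair_graph_bowtie_2_2: "pair_graph bowtie_2_2"
proof -
  have fin: "finite (pverts bowtie_2_2)" by (simp add: bowtie_2_2_def)
  have sub: "parcs bowtie_2_2 \<subseteq> pverts bowtie_2_2 \<times> pverts bowtie_2_2"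
    unfolding bowtie_2_2_def pair_pre_digraph.simps
    by (intro Un_least complete_arcs_subset Sigma_mono) auto
  have "finite (parcs bowtie_2_2)"
    using finite_subset[OF sub finite_cartesian_product[OF fin fin]] .
  moreover have "sym (parcs bowtie_2_2)"
    unfolding bowtie_2_2_def complete_arcs_def by (auto simp: sym_def)
  moreover have "fst e \<noteq> snd e" if "e \<in> parcs bowtie_2_2" for e
    using that unfolding bowtie_2_2_def complete_arcs_def by auto
  ultimately show ?thesis
    using fin sub
    by unfold_locales (auto simp: symmetric_def)
qed

lemma pair_graph_dumbbell_3_3: "pair_graph dumbbell_3_3"
proof -
  have fin: "finite (pverts dumbbell_3_3)" by (simp add: dumbbell_3_3_def)
  have sub: "parcs dumbbell_3_3 \<subseteq> pverts dumbbell_3_3 \<times> pverts dumbbell_3_3"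
    unfolding dumbbell_3_3_def pair_pre_digraph.simps
    by (intro Un_least complete_arcs_subset Sigma_mono) auto
  have "finite (parcs dumbbell_3_3)"
    using finite_subset[OF sub finite_cartesian_product[OF fin fin]] .
  moreover have "sym (parcs dumbbell_3_3)"
    unfolding dumbbell_3_3_def complete_arcs_def by (auto simp: sym_def)
  moreover have "fst e \<noteq> snd e" if "e \<in> parcs dumbbell_3_3" for e
    using that unfolding dumbbell_3_3_def complete_arcs_def by auto
  ultimately show ?thesis
    using fin sub
    by unfold_locales (auto simp: symmetric_def)
qed

lemma (in pair_graph) finite_clique_cards: "finite {card K | K. is_clique G K}"
proof -
  have "{card K | K. is_clique G K} \<subseteq> card ` Pow (pverts G)"
    by (auto simp: is_clique_def)
  then show ?thesis by (rule finite_subset) simp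
qed

lemma (in pair_graph) ex_proper_coloring: "\<exists>k c. proper_coloring G k c"
proof -
  obtain f :: "'a \<Rightarrow> nat" and n where f: "f ` pverts G = {i. i < n}" "inj_on f (pverts G)"
    using finite_imp_inj_to_nat_seg[of "pverts G"] by auto
  then have "proper_coloring G n f"
    using in_arcsD1 in_arcsD2 pair_no_loops
    by (fastforce simp: proper_coloring_def dest: inj_onD)
  then show ?thesis by blast
qed

lemma contains_induced_iff:
  assumes "pair_graph G" "pair_graph H"
  shows "contains_induced G H \<longleftrightarrow>
    (\<exists>f. inj_on f (pverts H) \<and> f ` pverts H \<subseteq> pverts G \<and>
      (\<forall>u\<in>pverts H. \<forall>v\<in>pverts H. (f u, f v) \<in> parcs G \<longleftrightarrow> (u, v) \<in> parcs H))"
proof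
  interpret G: pair_graph G by fact
  interpret H: pair_graph H by fact
  assume "contains_induced G H"
  then obtain S h where S: "induced_subgraph S (with_proj G)"
    and h: "pre_digraph.digraph_isomorphism S h" "with_proj H = app_iso h S"
    by (auto simp: contains_induced_def digraph_iso_def)
  interpret S: wf_digraph S using S by (auto simp: induced_subgraph_def subgraph_def)
  have sub: "verts S \<subseteq> pverts G" "tail S = fst" "head S = snd"
    and arcs: "arcs S = {e \<in> parcs G. fst e \<in> verts S \<and> snd e \<in> verts S}"
    using S by (auto simp: induced_subgraph_def subgraph_def compatible_def)
  have inj: "inj_on (iso_verts h) (verts S)"
    and ends: "\<And>a. a \<in> arcs S \<Longrightarrow> iso_verts h (fst a) = iso_tail h (iso_arcs h a)
      \<and> iso_verts h (snd a) = iso_head h (iso_arcs h a)"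
    using h(1) sub by (auto simp: S.digraph_isomorphism_def)
  have H: "pverts H = iso_verts h ` verts S" "parcs H = iso_arcs h ` arcs S"
    "iso_tail h = fst" "iso_head h = snd"
    using h(2) by (auto simp: with_proj_def app_iso_def)
  have arcs_eq: "iso_arcs h a = (iso_verts h (fst a), iso_verts h (snd a))" if "a \<in> arcs S" for a
    using ends[OF that] H by (metis prod.collapse)
  let ?f = "the_inv_into (verts S) (iso_verts h)"
  have f: "?f (iso_verts h x) = x" if "x \<in> verts S" for x
    using inj that by (rule the_inv_into_f_f)
  have iff: "(x, y) \<in> parcs G \<longleftrightarrow> (iso_verts h x, iso_verts h y) \<in> parcs H"
    if xy: "x \<in> verts S" "y \<in> verts S" for x y
  proof
    assume "(x, y) \<in> parcs G"
    then have "(x, y) \<in> arcs S" using xy arcs by auto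
    then show "(iso_verts h x, iso_verts h y) \<in> parcs H"
      using arcs_eq[of "(x, y)"] H(2) by (metis fst_conv image_eqI snd_conv)
  next
    assume "(iso_verts h x, iso_verts h y) \<in> parcs H"
    then obtain a where a: "a \<in> arcs S" "iso_arcs h a = (iso_verts h x, iso_verts h y)"
      using H(2) by auto
    then have "iso_verts h (fst a) = iso_verts h x" "iso_verts h (snd a) = iso_verts h y"
      using arcs_eq[OF a(1)] by simp_all
    moreover have "fst a \<in> verts S" "snd a \<in> verts S" using a(1) arcs by auto
    ultimately have "fst a = x" "snd a = y"
      by (simp_all add: inj_onD[OF inj] xy)
    then have "a = (x, y)" by (simp add: prod_eq_iff)
    moreover have "a \<in> parcs G" using a(1) unfolding arcs by blast
    ultimately show "(x, y) \<in> parcs G" by simp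
  qed
  show "\<exists>f. inj_on f (pverts H) \<and> f ` pverts H \<subseteq> pverts G \<and>
      (\<forall>u\<in>pverts H. \<forall>v\<in>pverts H. (f u, f v) \<in> parcs G \<longleftrightarrow> (u, v) \<in> parcs H)"
  proof (intro exI conjI)
    show "inj_on ?f (pverts H)" using inj by (simp add: H(1) inj_on_the_inv_into)
    show "?f ` pverts H \<subseteq> pverts G" using f sub(1) by (auto simp: H(1))
    show "\<forall>u\<in>pverts H. \<forall>v\<in>pverts H. (?f u, ?f v) \<in> parcs G \<longleftrightarrow> (u, v) \<in> parcs H"
      unfolding H(1) using f iff by simp
  qed
next
  interpret G: pair_graph G by fact
  interpret H: pair_graph H by fact
  assume "\<exists>f. inj_on f (pverts H) \<and> f ` pverts H \<subseteq> pverts G \<and>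
      (\<forall>u\<in>pverts H. \<forall>v\<in>pverts H. (f u, f v) \<in> parcs G \<longleftrightarrow> (u, v) \<in> parcs H)"
  then obtain f where f: "inj_on f (pverts H)" "f ` pverts H \<subseteq> pverts G"
    and iff: "\<And>u v. u \<in> pverts H \<Longrightarrow> v \<in> pverts H \<Longrightarrow> (f u, f v) \<in> parcs G \<longleftrightarrow> (u, v) \<in> parcs H"
    by blast
  define A where "A = f ` pverts H"
  define S where "S = with_proj \<lparr> pverts = A, parcs = {e \<in> parcs G. fst e \<in> A \<and> snd e \<in> A} \<rparr>"
  define g where "g = the_inv_into (pverts H) f"
  define h where "h = \<lparr> iso_verts = g, iso_arcs = (\<lambda>a. (g (fst a), g (snd a))),
    iso_head = snd, iso_tail = fst \<rparr>"
  have g: "g (f x) = x" if "x \<in> pverts H" for x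
    using f(1) that by (simp add: g_def the_inv_into_f_f)
  have wf: "wf_digraph S" by unfold_locales (auto simp: S_def)
  have ind: "induced_subgraph S (with_proj G)"
    using wf f(2) G.wf_digraph
    by (auto simp: induced_subgraph_def subgraph_def compatible_def S_def A_def)
  have ginj: "inj_on g A" using g by (auto simp: A_def inj_on_def)
  have "pre_digraph.digraph_isomorphism S h"
    using wf ginj
    by (auto simp: pre_digraph.digraph_isomorphism_def h_def S_def inj_on_def)
  moreover have "with_proj H = app_iso h S"
  proof -
    have "pverts H = g ` A" using g by (force simp: A_def)
    moreover have "parcs H = (\<lambda>a. (g (fst a), g (snd a))) ` {e \<in> parcs G. fst e \<in> A \<and> snd e \<in> A}"
    proof (intro set_eqI iffI)
      fix a assume a: "a \<in> parcs H"
      then have v: "fst a \<in> pverts H" "snd a \<in> pverts H"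
        by (auto intro: H.arc_fst_in_verts H.arc_snd_in_verts)
      then have "(f (fst a), f (snd a)) \<in> parcs G" using iff a by simp
      then show "a \<in> (\<lambda>a. (g (fst a), g (snd a))) ` {e \<in> parcs G. fst e \<in> A \<and> snd e \<in> A}"
        using v g by (intro image_eqI[of _ _ "(f (fst a), f (snd a))"]) (auto simp: A_def)
    next
      fix a assume "a \<in> (\<lambda>a. (g (fst a), g (snd a))) ` {e \<in> parcs G. fst e \<in> A \<and> snd e \<in> A}"
      then show "a \<in> parcs H" using iff g by (auto simp: A_def)
    qed
    ultimately show ?thesis by (simp add: with_proj_def app_iso_def h_def S_def)
  qed
  ultimately show "contains_induced G H"
    using ind by (auto simp: contains_induced_def digraph_iso_def)
qed

end

theory Submission
  imports Defs
begin

text \<open>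
  Let \<open>K\<close> be a maximum clique and let \<open>R\<close> be the set of vertices outside \<open>K\<close> without a neighbour in
  \<open>K\<close>. Bowtie-freeness says that every neighbourhood is \<open>2K\<^sub>2\<close>-free, so Wagon's theorem colours the
  neighbourhood of each vertex of \<open>K\<close> with \<open>\<omega> choose 2\<close> colours. A vertex \<open>x \<notin> K\<close> with a neighbour in
  \<open>K\<close> also has a non-neighbour in \<open>K\<close>; hence, by \<open>P\<^sub>5\<close>-freeness, if \<open>x\<close> is adjacent to one end of an
  edge of \<open>R\<close>, it is adjacent to both ends. This gives a bowtie if \<open>x\<close> has two neighbours in \<open>K\<close>, and
  a dumbbell otherwise. So the vertices of \<open>R\<close> that have a neighbour outside \<open>R\<close> are isolated in \<open>R\<close>
  and need only one colour, and the rest of \<open>R\<close> is a union of components of the graph, to which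
  induction applies.
\<close>

section \<open>Colourings and cliques of a vertex set under a binary relation\<close>

definition colorable :: "'a rel \<Rightarrow> 'a set \<Rightarrow> nat \<Rightarrow> bool" where
  "colorable E S n \<longleftrightarrow> (\<exists>c. c ` S \<subseteq> {..<n} \<and> (\<forall>u\<in>S. \<forall>v\<in>S. (u, v) \<in> E \<longrightarrow> c u \<noteq> c v))"

definition clique :: "'a rel \<Rightarrow> 'a set \<Rightarrow> bool" where
  "clique E K \<longleftrightarrow> (\<forall>u\<in>K. \<forall>v\<in>K. u \<noteq> v \<longrightarrow> (u, v) \<in> E)"

definition stable_set :: "'a rel \<Rightarrow> 'a set \<Rightarrow> bool" where
  "stable_set E S \<longleftrightarrow> (\<forall>u\<in>S. \<forall>v\<in>S. (u, v) \<notin> E)"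

lemma colorable_mono:
  assumes "colorable E T m" "S \<subseteq> T" "m \<le> n"
  shows "colorable E S n"
proof -
  obtain c where c: "c ` T \<subseteq> {..<m}" "\<forall>u\<in>T. \<forall>v\<in>T. (u, v) \<in> E \<longrightarrow> c u \<noteq> c v"
    using assms(1) unfolding colorable_def by (elim exE conjE)
  have "c ` S \<subseteq> {..<n}" using c(1) assms(2,3) by fastforce
  then show ?thesis
    unfolding colorable_def using c(2) assms(2) by (intro exI[of _ c]) (auto dest: subsetD)
qed

lemma colorable_stable: "stable_set E S \<Longrightarrow> colorable E S 1"
  unfolding colorable_def stable_set_def by (intro exI[of _ "\<lambda>_. 0"]) auto

lemma colorable_Un:
  assumes "colorable E A m" "colorable E B n"
  shows "colorable E (A \<union> B) (m + n)"
proof -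
  obtain a where a: "a ` A \<subseteq> {..<m}" "\<forall>u\<in>A. \<forall>v\<in>A. (u, v) \<in> E \<longrightarrow> a u \<noteq> a v"
    using assms(1) unfolding colorable_def by (elim exE conjE)
  obtain b where b: "b ` B \<subseteq> {..<n}" "\<forall>u\<in>B. \<forall>v\<in>B. (u, v) \<in> E \<longrightarrow> b u \<noteq> b v"
    using assms(2) unfolding colorable_def by (elim exE conjE)
  define c where "c x = (if x \<in> A then a x else m + b x)" for x
  have "c x < m + n" if "x \<in> A \<union> B" for x
    using that a(1) b(1) by (force simp: c_def)
  moreover have "c u \<noteq> c v" if "u \<in> A \<union> B" "v \<in> A \<union> B" "(u, v) \<in> E" for u v
  proof -
    have am: "a x < m" if "x \<in> A" for x using that a(1) by auto
    show ?thesis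
    proof (cases "u \<in> A \<longleftrightarrow> v \<in> A")
      case True
      then show ?thesis using that a(2) b(2) by (auto simp: c_def)
    next
      case False
      then show ?thesis using am[of u] am[of v] by (auto simp: c_def)
    qed
  qed
  ultimately show ?thesis unfolding colorable_def by (intro exI[of _ c]) auto
qed

lemma colorable_UN:
  assumes "finite I" "\<And>i. i \<in> I \<Longrightarrow> colorable E (A i) m"
  shows "colorable E (\<Union>i\<in>I. A i) (card I * m)"
  using assms
proof (induction I rule: finite_induct)
  case empty
  then show ?case by (simp add: colorable_def)
next
  case (insert i I)
  then have "colorable E (A i \<union> (\<Union>i\<in>I. A i)) (m + card I * m)"
    by (intro colorable_Un) auto
  then show ?case using insert.hyps by simp
qed

text \<open>With no edge between the two parts, their colourings can share one palette. This keeps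
  the number of colours fixed during the induction in \<open>colorable_of_forbidden\<close>.\<close>

lemma colorable_anticomplete_Un:
  assumes "sym E" "colorable E A n" "colorable E B n"
    and anti: "\<And>u v. u \<in> A \<Longrightarrow> v \<in> B \<Longrightarrow> (u, v) \<notin> E"
  shows "colorable E (A \<union> B) n"
proof -
  obtain a where a: "a ` A \<subseteq> {..<n}" "\<forall>u\<in>A. \<forall>v\<in>A. (u, v) \<in> E \<longrightarrow> a u \<noteq> a v"
    using assms(2) unfolding colorable_def by (elim exE conjE)
  obtain b where b: "b ` B \<subseteq> {..<n}" "\<forall>u\<in>B. \<forall>v\<in>B. (u, v) \<in> E \<longrightarrow> b u \<noteq> b v"
    using assms(3) unfolding colorable_def by (elim exE conjE)
  have "(v, u) \<notin> E" if "u \<in> A" "v \<in> B" for u v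
    using anti[OF that] assms(1) by (meson symD)
  then show ?thesis
    unfolding colorable_def using a b anti
    by (intro exI[of _ "\<lambda>x. if x \<in> A then a x else b x"]) auto
qed

lemma ex_maximum_clique:
  assumes "finite S"
  obtains K where "K \<subseteq> S" "clique E K" "\<And>L. L \<subseteq> S \<Longrightarrow> clique E L \<Longrightarrow> card L \<le> card K"
proof -
  let ?C = "{K. K \<subseteq> S \<and> clique E K}"
  have "finite ?C" "?C \<noteq> {}" using assms by (auto simp: clique_def)
  then have "Max (card ` ?C) \<in> card ` ?C" "\<forall>L\<in>?C. card L \<le> Max (card ` ?C)"
    by simp_all
  then show ?thesis using that by fastforce
qed

section \<open>Maximum cliques and Wagon's bound\<close>

context
  fixes E :: "'a rel"
  assumes sym: "sym E" and irr: "irrefl E"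
begin

lemma clique_insert:
  "clique E K \<Longrightarrow> (\<And>k. k \<in> K \<Longrightarrow> (x, k) \<in> E) \<Longrightarrow> clique E (insert x K)"
  unfolding clique_def using symD[OF sym] by blast

text \<open>Otherwise \<open>x\<close> would extend \<open>K\<close> to a larger clique inside
  \<open>S\<close>.\<close>

lemma ex_non_neighbour_in_maximum_clique:
  assumes "finite S" "K \<subseteq> S" "clique E K"
    and max: "\<And>L. L \<subseteq> S \<Longrightarrow> clique E L \<Longrightarrow> card L \<le> card K"
    and "x \<in> S" "x \<notin> K"
  shows "\<exists>k\<in>K. (x, k) \<notin> E"
proof (rule ccontr)
  assume "\<not> ?thesis"
  then have "clique E (insert x K)" using assms(3) by (auto intro: clique_insert)
  then have "card (insert x K) \<le> card K" using assms by (intro max) auto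
  moreover have "finite K" using assms finite_subset by blast
  ultimately show False using assms(6) by simp
qed

text \<open>
  Wagon's theorem. Given a maximum clique \<open>K\<close>, the vertices missing two fixed vertices of \<open>K\<close> are stable
  because there is no \<open>2K\<^sub>2\<close>, and the vertices missing exactly one fixed vertex of \<open>K\<close> are
  stable by maximality. The assumption on \<open>a b c d\<close> needs no distinctness: any coincidence among
  them makes one of the four pairs an edge.
\<close>

lemma colorable_2K2_free:
  assumes fin: "finite S"
    and free: "\<And>a b c d. a \<in> S \<Longrightarrow> b \<in> S \<Longrightarrow> c \<in> S \<Longrightarrow> d \<in> S \<Longrightarrow> (a, b) \<in> E \<Longrightarrow> (c, d) \<in> E
      \<Longrightarrow> (a, c) \<in> E \<or> (a, d) \<in> E \<or> (b, c) \<in> E \<or> (b, d) \<in> E"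
    and cl: "\<And>L. L \<subseteq> S \<Longrightarrow> clique E L \<Longrightarrow> card L \<le> q"
  shows "colorable E S (Suc q choose 2)"
proof -
  obtain K where K: "K \<subseteq> S" "clique E K"
    and max: "\<And>L. L \<subseteq> S \<Longrightarrow> clique E L \<Longrightarrow> card L \<le> card K"
    using ex_maximum_clique[OF fin] by metis
  have finK: "finite K" using K(1) fin finite_subset by blast
  \<comment> \<open>For \<open>k\<close> in \<open>K\<close>, irreflexivity puts \<open>k\<close>
    itself into \<open>D k\<close>, so these classes also take care of the vertices of
    \<open>K\<close>.\<close>
  define D where "D k = {x \<in> S. \<forall>l\<in>K. (x, l) \<notin> E \<longleftrightarrow> l = k}" for k
  define C where "C e = {x \<in> S. \<forall>l\<in>e. (x, l) \<notin> E}" for e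
  define P where "P = {e. e \<subseteq> K \<and> card e = 2}"
  have D: "colorable E (D k) 1" if k: "k \<in> K" for k
  proof (rule colorable_stable, unfold stable_set_def, intro ballI notI)
    fix x y assume xy: "x \<in> D k" "y \<in> D k" "(x, y) \<in> E"
    \<comment> \<open>Replacing \<open>k\<close> by both \<open>x\<close> and \<open>y\<close> would
      give a clique with one vertex more than \<open>K\<close>.\<close>
    have c: "clique E (insert x (insert y (K - {k})))"
    proof (intro clique_insert)
      show "clique E (K - {k})" using K(2) by (auto simp: clique_def)
    qed (use xy in \<open>auto simp: D_def\<close>)
    have "card (insert x (insert y (K - {k}))) \<le> card K"
      by (rule max[OF _ c]) (use xy K(1) in \<open>auto simp: D_def\<close>)
    moreover have "x \<noteq> y" using xy(3) irr by (auto simp: irrefl_def)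
    moreover have "z \<notin> K - {k}" if "z \<in> D k" for z
      using that irr by (auto simp: D_def irrefl_def)
    ultimately show False using xy finK k
      by (simp add: card_Diff_singleton)
  qed
  have C: "colorable E (C e) 1" if e: "e \<in> P" for e
  proof (rule colorable_stable, unfold stable_set_def, intro ballI notI)
    fix x y assume xy: "x \<in> C e" "y \<in> C e" "(x, y) \<in> E"
    obtain k l where kl: "e = {k, l}" "k \<noteq> l" "k \<in> K" "l \<in> K"
      using e by (auto simp: P_def card_2_iff)
    then have "(k, l) \<in> E" using K(2) by (auto simp: clique_def)
    then show False using free[of x y k l] xy kl K(1) by (auto simp: C_def)
  qed
  have cover: "S \<subseteq> (\<Union>k\<in>K. D k) \<union> (\<Union>e\<in>P. C e)"
  proof
    fix x assume x: "x \<in> S"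
    have "\<exists>k\<in>K. (x, k) \<notin> E"
    proof (cases "x \<in> K")
      case True
      then show ?thesis using irr by (auto simp: irrefl_def)
    next
      case False
      then show ?thesis using ex_non_neighbour_in_maximum_clique[OF fin K max x] by blast
    qed
    then obtain k where k: "k \<in> K" "(x, k) \<notin> E" by blast
    show "x \<in> (\<Union>k\<in>K. D k) \<union> (\<Union>e\<in>P. C e)"
    proof (cases "x \<in> D k")
      case True
      then show ?thesis using k by blast
    next
      case False
      then obtain l where "l \<in> K" "(x, l) \<notin> E" "l \<noteq> k" using k x by (auto simp: D_def)
      then have "{k, l} \<in> P" "x \<in> C {k, l}" using k x by (auto simp: P_def C_def)
      then show ?thesis by blast
    qed
  qed
  have "finite P" using finK by (simp add: P_def)
  then have "colorable E ((\<Union>k\<in>K. D k) \<union> (\<Union>e\<in>P. C e)) (card K * 1 + card P * 1)"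
    using finK C D by (intro colorable_Un colorable_UN) auto
  \<comment> \<open>Pascal's rule: one colour per vertex of \<open>K\<close> and one per pair of
    them.\<close>
  moreover have "card K * 1 + card P * 1 = Suc (card K) choose 2"
    using n_subsets[OF finK, of 2] by (simp add: P_def numeral_2_eq_2)
  moreover have "Suc (card K) choose 2 \<le> Suc q choose 2"
    using cl[OF K] by (intro binomial_right_mono) auto
  ultimately show ?thesis using cover by (auto intro: colorable_mono)
qed

section \<open>Structure around a maximum clique under the three forbidden configurations\<close>

text \<open>Each conclusion lists the non-edges of the forbidden graph. Identifying two of its
  vertices produces a loop or, up to symmetry, one of the listed edges, so each condition says
  exactly that there is no induced copy.\<close>

context
  assumes bowtie: "\<And>v a b c d. (v, a) \<in> E \<Longrightarrow> (v, b) \<in> E \<Longrightarrow> (v, c) \<in> E \<Longrightarrow> (v, d) \<in> E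
      \<Longrightarrow> (a, b) \<in> E \<Longrightarrow> (c, d) \<in> E
      \<Longrightarrow> (a, c) \<in> E \<or> (a, d) \<in> E \<or> (b, c) \<in> E \<or> (b, d) \<in> E"
    and P5: "\<And>a b c d e. (a, b) \<in> E \<Longrightarrow> (b, c) \<in> E \<Longrightarrow> (c, d) \<in> E \<Longrightarrow> (d, e) \<in> E
      \<Longrightarrow> (a, c) \<in> E \<or> (a, d) \<in> E \<or> (a, e) \<in> E \<or> (b, d) \<in> E \<or> (b, e) \<in> E \<or> (c, e) \<in> E"
    and dumbbell: "\<And>a b c d e f. (a, b) \<in> E \<Longrightarrow> (a, c) \<in> E \<Longrightarrow> (b, c) \<in> E
      \<Longrightarrow> (d, e) \<in> E \<Longrightarrow> (d, f) \<in> E \<Longrightarrow> (e, f) \<in> E \<Longrightarrow> (a, d) \<in> E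
      \<Longrightarrow> (a, e) \<in> E \<or> (a, f) \<in> E \<or> (b, d) \<in> E \<or> (b, e) \<in> E \<or> (b, f) \<in> E
        \<or> (c, d) \<in> E \<or> (c, e) \<in> E \<or> (c, f) \<in> E"
begin

lemma attached_imp_isolated:
  assumes fin: "finite S" and K: "K \<subseteq> S" "clique E K"
    and max: "\<And>L. L \<subseteq> S \<Longrightarrow> clique E L \<Longrightarrow> card L \<le> card K"
    and x: "x \<in> S" "x \<notin> K" "k \<in> K" "(x, k) \<in> E"
    and t: "t \<in> S" "t' \<in> S" "\<And>l. l \<in> K \<Longrightarrow> (t, l) \<notin> E" "\<And>l. l \<in> K \<Longrightarrow> (t', l) \<notin> E"
    and xt: "(x, t) \<in> E"
  shows "(t, t') \<notin> E"
proof
  assume tt: "(t, t') \<in> E"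
  note sD = symD[OF sym]
  have finK: "finite K" using K(1) fin finite_subset by blast
  obtain l where l: "l \<in> K" "(x, l) \<notin> E"
    using ex_non_neighbour_in_maximum_clique[OF fin K max x(1,2)] by blast
  then have "k \<noteq> l" using x by blast
  then have kl: "(l, k) \<in> E" using K(2) l(1) x(3) by (auto simp: clique_def)
  \<comment> \<open>Otherwise \<open>l\<close>, \<open>k\<close>, \<open>x\<close>,
    \<open>t\<close>, \<open>t'\<close> would be an induced path in this order.\<close>
  have xt': "(x, t') \<in> E"
    using P5[OF kl sD[OF x(4)] xt tt] l x(3) t(3,4) by (blast dest: sD)
  \<comment> \<open>This triangle forces the maximum clique \<open>K\<close> to have at least three
    vertices, hence a vertex \<open>m\<close> besides \<open>k\<close> and \<open>l\<close>.\<close>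
  have "clique E {x, t, t'}" "{x, t, t'} \<subseteq> S"
    using xt xt' tt x(1) t(1,2) by (auto simp: clique_def dest: sD)
  then have "card {x, t, t'} \<le> card K" by (intro max)
  moreover have "x \<noteq> t" "x \<noteq> t'" "t \<noteq> t'"
    using xt xt' tt irr by (auto simp: irrefl_def)
  ultimately have "card K \<ge> 3" by simp
  then have "\<not> K \<subseteq> {k, l}"
    using card_mono[of "{k, l}" K] \<open>k \<noteq> l\<close> by auto
  then obtain m where m: "m \<in> K" "m \<noteq> k" "m \<noteq> l" by blast
  then have ml: "(m, l) \<in> E" "(k, m) \<in> E" "(k, l) \<in> E"
    using K(2) l(1) x(3) \<open>k \<noteq> l\<close> by (auto simp: clique_def)
  \<comment> \<open>If \<open>x\<close> is adjacent to \<open>m\<close>, the edges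
    \<open>k m\<close> and \<open>t t'\<close> form a bowtie with centre \<open>x\<close>. If not,
    the edge \<open>x k\<close> joins the triangles \<open>x t t'\<close> and \<open>k m l\<close>
    into a dumbbell.\<close>
  show False
  proof (cases "(x, m) \<in> E")
    case True
    then show False
      using bowtie[OF x(4) True xt xt' ml(2) tt] t(3,4) x(3) m(1) by (blast dest: sD)
  next
    case False
    then show False
      using dumbbell[OF xt xt' tt ml(2,3,1) x(4)] t(3,4) x(3) m(1) l by blast
  qed
qed

text \<open>Here \<open>w\<close> is only an upper bound on clique sizes, so it passes unchanged to
  the smaller set in the induction. The three summands pay for the neighbourhoods of the vertices of
  \<open>K\<close>, for \<open>K\<close> itself and for the stable set \<open>R1\<close>.\<close>

lemma colorable_of_forbidden:
  assumes "finite S" and "\<And>L. L \<subseteq> S \<Longrightarrow> clique E L \<Longrightarrow> card L \<le> w"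
  shows "colorable E S (w * (w choose 2) + w + 1)"
  using assms
proof (induction S rule: finite_psubset_induct)
  case (psubset S)
  note fin = psubset.hyps and cl = psubset.prems
  note sD = symD[OF sym]
  show ?case
  proof (cases "S = {}")
    case True
    then show ?thesis by (simp add: colorable_def)
  next
    case False
    then obtain s where s: "s \<in> S" by blast
    obtain K where K: "K \<subseteq> S" "clique E K"
      and max: "\<And>L. L \<subseteq> S \<Longrightarrow> clique E L \<Longrightarrow> card L \<le> card K"
      using ex_maximum_clique[OF fin] by metis
    have "card {s} \<le> card K" using s by (intro max) (auto simp: clique_def)
    then have K1: "card K \<ge> 1" by simp
    then have finK: "finite K" and Kne: "K \<noteq> {}" by (auto intro: card_ge_0_finite)
    have w1: "card K \<le> w" using cl[OF K] .
    define N where "N k = {x \<in> S. (k, x) \<in> E}" for k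
    define M where "M = (\<Union>k\<in>K. N k) - K"
    define R where "R = S - (\<Union>k\<in>K. N k) - K"
    define R1 where "R1 = {t \<in> R. \<exists>x\<in>M. (x, t) \<in> E}"
    define A where "A = (\<Union>k\<in>K. N k) \<union> (K \<union> R1)"
    \<comment> \<open>Since \<open>t'\<close> ranges over all of \<open>R\<close>, this gives both
      that \<open>R1\<close> is stable and that no edge joins it to \<open>R - R1\<close>.\<close>
    have iso: "(t, t') \<notin> E" if t: "t \<in> R1" "t' \<in> R" for t t'
    proof -
      obtain x where x: "x \<in> M" "(x, t) \<in> E" using t(1) by (auto simp: R1_def)
      then obtain k where k: "x \<in> S" "x \<notin> K" "k \<in> K" "(x, k) \<in> E"
        by (auto simp: M_def N_def dest: sD)
      have R: "r \<in> S" "(r, l) \<notin> E" if "r \<in> R" "l \<in> K" for r l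
        using that by (auto simp: R_def N_def dest: sD)
      have "t \<in> R" using t(1) by (simp add: R1_def)
      then show ?thesis
        using attached_imp_isolated[OF fin K max k] R t(2) x(2) Kne by blast
    qed
    have nb: "colorable E (N k) (w choose 2)" if k: "k \<in> K" for k
    proof -
      \<comment> \<open>Adding \<open>k\<close> to a clique in \<open>N k\<close> gives a clique in
        \<open>S\<close>, so cliques in \<open>N k\<close> have at most \<open>w - 1\<close>
        vertices.\<close>
      have "colorable E (N k) (Suc (w - 1) choose 2)"
      proof (rule colorable_2K2_free)
        show "finite (N k)" using fin by (simp add: N_def)
        show "(a, c) \<in> E \<or> (a, d) \<in> E \<or> (b, c) \<in> E \<or> (b, d) \<in> E"
          if "a \<in> N k" "b \<in> N k" "c \<in> N k" "d \<in> N k" "(a, b) \<in> E" "(c, d) \<in> E" for a b c d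
          using that bowtie[of k a b c d] by (simp add: N_def)
        show "card L \<le> w - 1" if L: "L \<subseteq> N k" "clique E L" for L
        proof -
          have "insert k L \<subseteq> S" using L(1) k K(1) by (auto simp: N_def)
          moreover have "clique E (insert k L)"
            using L by (intro clique_insert) (auto simp: N_def)
          ultimately have "card (insert k L) \<le> w" by (rule cl)
          moreover have "k \<notin> L" using L(1) irr by (auto simp: N_def irrefl_def)
          moreover have "finite L" using L(1) fin by (auto simp: N_def intro: finite_subset)
          ultimately show ?thesis by simp
        qed
      qed
      then show ?thesis using K1 w1 by simp
    qed
    have "colorable E (\<Union>k\<in>K. {k}) (card K * 1)"
      using finK irr by (intro colorable_UN colorable_stable) (auto simp: stable_set_def irrefl_def)
    moreover have "colorable E R1 1"
      using iso by (intro colorable_stable) (auto simp: stable_set_def R1_def)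
    ultimately have "colorable E A (card K * (w choose 2) + (card K * 1 + 1))"
      unfolding A_def using nb finK by (intro colorable_Un colorable_UN) auto
    moreover have "card K * (w choose 2) + (card K * 1 + 1) \<le> w * (w choose 2) + w + 1"
      using w1 by (simp add: add_mono)
    ultimately have "colorable E A (w * (w choose 2) + w + 1)"
      by (auto intro: colorable_mono)
    moreover have "colorable E (R - R1) (w * (w choose 2) + w + 1)"
    proof (rule psubset.IH)
      show "R - R1 \<subset> S" using K(1) Kne by (auto simp: R_def)
      show "card L \<le> w" if "L \<subseteq> R - R1" "clique E L" for L
        using that by (intro cl) (auto simp: R_def)
    qed
    \<comment> \<open>The three cases are excluded by the choice of \<open>R\<close>, by the choice
      of \<open>R1\<close> and by \<open>iso\<close>, respectively.\<close>
    moreover have "(u, v) \<notin> E" if u: "u \<in> A" and v: "v \<in> R - R1" for u v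
    proof -
      consider "u \<in> K" | "u \<in> M" | "u \<in> R1" using u by (auto simp: A_def M_def)
      then show ?thesis
      proof cases
        case 1
        then show ?thesis using v by (auto simp: R_def N_def)
      next
        case 2
        then show ?thesis using v by (auto simp: R1_def)
      next
        case 3
        then show ?thesis using v iso by blast
      qed
    qed
    ultimately have "colorable E (A \<union> (R - R1)) (w * (w choose 2) + w + 1)"
      by (intro colorable_anticomplete_Un[OF sym])
    then show ?thesis by (rule colorable_mono) (auto simp: A_def R_def)
  qed
qed

end

end

section \<open>Transfer to finite graphs and the chromatic number\<close>

text \<open>Listing the image of the embedding turns an induced copy into finitely many checks;
  symmetry and the absence of loops reduce them to index pairs with \<open>i < j\<close>.\<close>

lemma contains_inducedI:
  fixes xs :: "'a list"
  assumes "pair_graph G" "pair_graph H" and V: "pverts H = {..<length xs}"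
    and xs: "distinct xs" "set xs \<subseteq> pverts G"
    and arcs: "\<forall>j<length xs. \<forall>i<j. (xs ! i, xs ! j) \<in> parcs G \<longleftrightarrow> (i, j) \<in> parcs H"
  shows "contains_induced G H"
proof -
  interpret G: pair_graph G by fact
  interpret H: pair_graph H by fact
  have "(xs ! i, xs ! j) \<in> parcs G \<longleftrightarrow> (i, j) \<in> parcs H" if "i < length xs" "j < length xs" for i j
  proof (cases i j rule: linorder_cases)
    case less
    then show ?thesis using arcs that by blast
  next
    case equal
    then show ?thesis using G.pair_no_loops H.pair_no_loops by force
  next
    case greater
    then have "(xs ! j, xs ! i) \<in> parcs G \<longleftrightarrow> (j, i) \<in> parcs H" using arcs that by blast
    then show ?thesis using G.graph_symmetric H.graph_symmetric by blast
  qed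
  then show ?thesis
    unfolding contains_induced_iff[OF assms(1,2)] V
    using xs by (intro exI[of _ "(!) xs"]) (auto simp: inj_on_nth)
qed

theorem theorem2p9:
  fixes G :: "'a pair_pre_digraph"
  assumes "pair_graph G"
    and "free_of {bowtie_2_2, path_graph 5, dumbbell_3_3} G"
    and "clique_number G \<ge> 3"
  shows "chromatic_number G \<le>
    2 * clique_number G + clique_number G * (clique_number G choose 2) + 2"
proof -
  interpret pair_graph G by fact
  let ?E = "parcs G" and ?w = "clique_number G"
  have sym: "sym ?E" using graph_symmetric by (auto intro: symI)
  have irr: "irrefl ?E" using pair_no_loops by (force simp: irrefl_def)
  note sD = symD[OF sym]
  have ir: "(x, x) \<notin> ?E" for x using irr by (simp add: irrefl_def)
  have "colorable ?E (pverts G) (?w * (?w choose 2) + ?w + 1)"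
  proof (rule colorable_of_forbidden[OF sym irr])
    fix v a b c d
    assume e: "(v, a) \<in> ?E" "(v, b) \<in> ?E" "(v, c) \<in> ?E" "(v, d) \<in> ?E" "(a, b) \<in> ?E" "(c, d) \<in> ?E"
    show "(a, c) \<in> ?E \<or> (a, d) \<in> ?E \<or> (b, c) \<in> ?E \<or> (b, d) \<in> ?E"
    proof (rule ccontr)
      assume n: "\<not> ?thesis"
      note n = n[unfolded de_Morgan_disj]
      have "contains_induced G bowtie_2_2"
      \<comment> \<open>The list follows the vertex labels of \<open>bowtie_2_2\<close>, so the
        centre \<open>v\<close> comes last, at position 4.\<close>
      proof (rule contains_inducedI[where xs = "[a, b, c, d, v]", OF assms(1) pair_graph_bowtie_2_2])
        show "pverts bowtie_2_2 = {..<length [a, b, c, d, v]}" by (auto simp: bowtie_2_2_def)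
        show "distinct [a, b, c, d, v]" using e e[THEN sD] n ir by auto
        show "set [a, b, c, d, v] \<subseteq> pverts G" using e by (auto dest: in_arcsD1 in_arcsD2)
        show "\<forall>j<length [a, b, c, d, v]. \<forall>i<j.
            ([a, b, c, d, v] ! i, [a, b, c, d, v] ! j) \<in> ?E \<longleftrightarrow> (i, j) \<in> parcs bowtie_2_2"
          using e e[THEN sD] n by (simp add: numeral_eq_Suc All_less_Suc bowtie_2_2_def complete_arcs_def)
      qed
      then show False using assms(2) by (simp add: free_of_def)
    qed
  next
    fix a b c d f
    assume e: "(a, b) \<in> ?E" "(b, c) \<in> ?E" "(c, d) \<in> ?E" "(d, f) \<in> ?E"
    show "(a, c) \<in> ?E \<or> (a, d) \<in> ?E \<or> (a, f) \<in> ?E \<or> (b, d) \<in> ?E \<or> (b, f) \<in> ?E \<or> (c, f) \<in> ?E"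
    proof (rule ccontr)
      assume n: "\<not> ?thesis"
      note n = n[unfolded de_Morgan_disj]
      have "contains_induced G (path_graph 5)"
      proof (rule contains_inducedI[where xs = "[a, b, c, d, f]", OF assms(1) pair_graph_path_graph])
        show "pverts (path_graph 5) = {..<length [a, b, c, d, f]}" by (simp add: path_graph_def)
        show "distinct [a, b, c, d, f]" using e e[THEN sD] n ir by auto
        show "set [a, b, c, d, f] \<subseteq> pverts G" using e by (auto dest: in_arcsD1 in_arcsD2)
        show "\<forall>j<length [a, b, c, d, f]. \<forall>i<j.
            ([a, b, c, d, f] ! i, [a, b, c, d, f] ! j) \<in> ?E \<longleftrightarrow> (i, j) \<in> parcs (path_graph 5)"
          using e e[THEN sD] n by (simp add: numeral_eq_Suc All_less_Suc path_graph_def)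
      qed
      then show False using assms(2) by (simp add: free_of_def)
    qed
  next
    fix a b c d f g
    assume e: "(a, b) \<in> ?E" "(a, c) \<in> ?E" "(b, c) \<in> ?E" "(d, f) \<in> ?E" "(d, g) \<in> ?E" "(f, g) \<in> ?E"
      "(a, d) \<in> ?E"
    show "(a, f) \<in> ?E \<or> (a, g) \<in> ?E \<or> (b, d) \<in> ?E \<or> (b, f) \<in> ?E \<or> (b, g) \<in> ?E
        \<or> (c, d) \<in> ?E \<or> (c, f) \<in> ?E \<or> (c, g) \<in> ?E"
    proof (rule ccontr)
      assume n: "\<not> ?thesis"
      note n = n[unfolded de_Morgan_disj]
      have "contains_induced G dumbbell_3_3"
      \<comment> \<open>Positions 0 and 3, the ends of the joining edge, are taken by
        \<open>a\<close> and \<open>d\<close>.\<close>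
      proof (rule contains_inducedI[where xs = "[a, b, c, d, f, g]", OF assms(1) pair_graph_dumbbell_3_3])
        show "pverts dumbbell_3_3 = {..<length [a, b, c, d, f, g]}" by (auto simp: dumbbell_3_3_def)
        show "distinct [a, b, c, d, f, g]" using e e[THEN sD] n ir by auto
        show "set [a, b, c, d, f, g] \<subseteq> pverts G" using e by (auto dest: in_arcsD1 in_arcsD2)
        show "\<forall>j<length [a, b, c, d, f, g]. \<forall>i<j.
            ([a, b, c, d, f, g] ! i, [a, b, c, d, f, g] ! j) \<in> ?E \<longleftrightarrow> (i, j) \<in> parcs dumbbell_3_3"
          using e e[THEN sD] n by (simp add: numeral_eq_Suc All_less_Suc dumbbell_3_3_def complete_arcs_def)
      qed
      then show False using assms(2) by (simp add: free_of_def)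
    qed
  next
    show "finite (pverts G)" by simp
    show "card L \<le> ?w" if "L \<subseteq> pverts G" "clique ?E L" for L
      unfolding clique_number_def
      by (rule Max_ge[OF finite_clique_cards]) (use that in \<open>auto simp: is_clique_def clique_def\<close>)
  qed
  then obtain c where "c ` pverts G \<subseteq> {..<?w * (?w choose 2) + ?w + 1}"
    and c: "\<And>u v. u \<in> pverts G \<Longrightarrow> v \<in> pverts G \<Longrightarrow> (u, v) \<in> ?E \<Longrightarrow> c u \<noteq> c v"
    unfolding colorable_def by blast
  moreover have "c u \<noteq> c v" if "(u, v) \<in> ?E" for u v
    using c[OF in_arcsD1[OF that] in_arcsD2[OF that] that] .
  ultimately have "\<exists>c. proper_coloring G (?w * (?w choose 2) + ?w + 1) c"
    unfolding proper_coloring_def by (intro exI[of _ c]) auto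
  then have "chromatic_number G \<le> ?w * (?w choose 2) + ?w + 1"
    unfolding chromatic_number_def by (rule Least_le)
  \<comment> \<open>The bound obtained lies below the required one by \<open>?w + 1\<close>.\<close>
  then show ?thesis by simp
qed

end
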